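(* Let $n\ge 1$, let $\mathcal{P}$ be a facet-bipartite $n$-polytope, and let $k$ be an even positive integer. Then the graph $\mathcal{P}|k$ is the flag graph of an $(n-2,n)$-flat $(n+1)$-polytope with $k$ facets isomorphic to $\mathcal{P}$.
   Context: For an integer $n\ge 1$, an $n$-pre-maniplex is an $n$-regular simple graph (its nodes are called flags) whose edges are colored with $0,1,\ldots,n-1$ so that each flag is incident to exactly one edge of each color; $\Phi^i$ denotes the other endpoint of the edge of color $i$ at the flag $\Phi$. An $n$-maniplex is a connected $n$-pre-maniplex in which $(\Phi^i)^j=(\Phi^j)^i$ for every flag $\Phi$ and all colors $i,j$ with $|i-j|>1$. An $n$-polytope (identified with its flag graph) is an $n$-maniplex satisfying the Path Intersection Property: for every pair of flags $\Phi,\Psi$ and all colors $i\le j$, if there is a path from $\Phi$ to $\Psi$ using only colors in $\{i,\ldots,n-1\}$ and another path from $\Phi$ to $\Psi$ using only colors in $\{0,\ldots,j\}$, then there is a path from $\Phi$ to $\Psi$ using only colors in $\{i,\ldots,j\}$. The $i$-faces of an $n$-maniplex are the connected components of the graph obtained by deleting all edges of color $i$; the $(n-1)$-faces are called facets. Two faces are incident if they have a flag in common. Isomorphisms are color-preserving graph isomorphisms. The facet graph of an $n$-polytope $\mathcal{P}$ is the simple graph whose nodes are the facets of $\mathcal{P}$, two nodes being adjacent if there is an edge of color $n-1$ in $\mathcal{P}$ between the corresponding facets. $\mathcal{P}$ is facet-bipartite if its facet graph is bipartite. A polytope is $(i,j)$-flat if every $i$-face is incident to every $j$-face; equivalently,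 for every flag $\Phi$ and every $j$-face there is a path from $\Phi$ to some flag in that $j$-face that uses no edge of color $i$. (If $i=-1$, no edges are deleted, so the whole polytope is the only $(-1)$-face.) Construction of $\mathcal{P}|k$: properly color the facet graph of $\mathcal{P}$ with red and blue, and color each flag by the color of the facet containing it. Take $k$ disjoint copies $\mathcal{P}_1,\ldots,\mathcal{P}_k$ of $\mathcal{P}$ (the layers), and write $\Phi_i$ for the copy in $\mathcal{P}_i$ of the flag $\Phi$ of $\mathcal{P}$; subscripts are taken modulo $k$. Keep all edges of colors $0,\ldots,n-1$ inside the layers, and add edges of color $n$ as follows: for each red flag $\Phi$, join $\Phi_1$ to $\Phi_2$, $\Phi_3$ to $\Phi_4$, ..., $\Phi_{k-1}$ to $\Phi_k$; for each blue flag $\Psi$, join $\Psi_2$ to $\Psi_3$, $\Psi_4$ to $\Psi_5$, ..., $\Psi_k$ to $\Psi_1$. The resulting edge-colored graph is $\mathcal{P}|k$. *)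

theory Defs
  imports Main
begin

text \<open>
  An edge-colored graph consists of its set of flags and, for each color \<open>c\<close>, the set
  of edges of color \<open>c\<close>, where an undirected edge is the two-element set of its endpoints.
  Both sets may be infinite.
\<close>

record 'a cgraph =
  flags :: "'a set"
  edges :: "nat \<Rightarrow> 'a set set"

text \<open>
  The third conjunct excludes parallel edges of different colors.  Being \<open>n\<close>-regular is not
  listed separately: it follows from having exactly one edge of each of the \<open>n\<close> colors at each flag.
\<close>

definition pre_maniplex :: "nat \<Rightarrow> 'a cgraph \<Rightarrow> bool" where
  "pre_maniplex n G \<longleftrightarrow>
     (\<forall>c e. e \<in> edges G c \<longrightarrow> c < n) \<and>
     (\<forall>c e. e \<in> edges G c \<longrightarrow> e \<subseteq> flags G \<and> card e = 2) \<and>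
     (\<forall>c d e. e \<in> edges G c \<and> e \<in> edges G d \<longrightarrow> c = d) \<and>
     n \<ge> 1 \<and>
     (\<forall>c<n. \<forall>\<Phi>\<in>flags G. \<exists>!e. e \<in> edges G c \<and> \<Phi> \<in> e)"

definition nbr :: "'a cgraph \<Rightarrow> nat \<Rightarrow> 'a \<Rightarrow> 'a" where
  "nbr G i \<Phi> = (THE \<Psi>. {\<Phi>, \<Psi>} \<in> edges G i)"

text \<open>\<open>linked G C\<close> relates two flags joined by a (possibly empty) path with colors in \<open>C\<close>.\<close>

definition linked :: "'a cgraph \<Rightarrow> nat set \<Rightarrow> ('a \<times> 'a) set" where
  "linked G C = {(\<Phi>, \<Psi>). \<exists>c\<in>C. {\<Phi>, \<Psi>} \<in> edges G c}\<^sup>*"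

definition connected_cgraph :: "'a cgraph \<Rightarrow> bool" where
  "connected_cgraph G \<longleftrightarrow>
     flags G \<noteq> {} \<and> (\<forall>\<Phi>\<in>flags G. \<forall>\<Psi>\<in>flags G. (\<Phi>, \<Psi>) \<in> linked G UNIV)"

definition maniplex :: "nat \<Rightarrow> 'a cgraph \<Rightarrow> bool" where
  "maniplex n G \<longleftrightarrow> pre_maniplex n G \<and> connected_cgraph G \<and>
     (\<forall>\<Phi>\<in>flags G. \<forall>i<n. \<forall>j<n. \<bar>int i - int j\<bar> > 1 \<longrightarrow>
        nbr G j (nbr G i \<Phi>) = nbr G i (nbr G j \<Phi>))"

definition path_intersection_property :: "nat \<Rightarrow> 'a cgraph \<Rightarrow> bool" where
  "path_intersection_property n G \<longleftrightarrow>
     (\<forall>\<Phi>\<in>flags G. \<forall>\<Psi>\<in>flags G. \<forall>i j. i \<le> j \<and> j < n \<longrightarrow>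
        (\<Phi>, \<Psi>) \<in> linked G {i..n-1} \<longrightarrow> (\<Phi>, \<Psi>) \<in> linked G {0..j} \<longrightarrow>
        (\<Phi>, \<Psi>) \<in> linked G {i..j})"

definition polytope :: "nat \<Rightarrow> 'a cgraph \<Rightarrow> bool" where
  "polytope n G \<longleftrightarrow> maniplex n G \<and> path_intersection_property n G"

definition cgraph_iso :: "'a cgraph \<Rightarrow> 'b cgraph \<Rightarrow> bool" where
  "cgraph_iso G H \<longleftrightarrow> (\<exists>f. bij_betw f (flags G) (flags H) \<and>
     (\<forall>c. \<forall>\<Phi>\<in>flags G. \<forall>\<Psi>\<in>flags G.
        {\<Phi>, \<Psi>} \<in> edges G c \<longleftrightarrow> {f \<Phi>, f \<Psi>} \<in> edges H c))"

definition induced :: "'a cgraph \<Rightarrow> 'a set \<Rightarrow> 'a cgraph" where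
  "induced G X = \<lparr>flags = X, edges = (\<lambda>c. {e \<in> edges G c. e \<subseteq> X})\<rparr>"

definition components :: "'a cgraph \<Rightarrow> 'a cgraph set" where
  "components G = induced G ` (flags G // linked G UNIV)"

definition delete_color :: "int \<Rightarrow> 'a cgraph \<Rightarrow> 'a cgraph" where
  "delete_color i G =
     \<lparr>flags = flags G, edges = (\<lambda>c. if int c = i then {} else edges G c)\<rparr>"

text \<open>
  The index is an integer so that \<open>i = -1\<close> is allowed: then no edge is deleted, and the only
  \<open>(-1)\<close>-face of a connected graph is the graph itself.  Faces are colored graphs, not
  just sets of flags, so that one can speak of faces being isomorphic to a polytope.
\<close>

definition faces :: "int \<Rightarrow> 'a cgraph \<Rightarrow> 'a cgraph set" where
  "faces i G = components (delete_color i G)"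

definition facets :: "nat \<Rightarrow> 'a cgraph \<Rightarrow> 'a cgraph set" where
  "facets n G = faces (int n - 1) G"

definition incident :: "'a cgraph \<Rightarrow> 'a cgraph \<Rightarrow> bool" where
  "incident F H \<longleftrightarrow> flags F \<inter> flags H \<noteq> {}"

definition flat :: "int \<Rightarrow> int \<Rightarrow> 'a cgraph \<Rightarrow> bool" where
  "flat i j G \<longleftrightarrow> (\<forall>F\<in>faces i G. \<forall>H\<in>faces j G. incident F H)"

text \<open>The facet graph is given as a pair of its node set and its set of (two-element) edges.\<close>

definition facet_graph :: "nat \<Rightarrow> 'a cgraph \<Rightarrow> 'a cgraph set \<times> 'a cgraph set set" where
  "facet_graph n P =
     (facets n P,
      {{F, H} |F H. F \<in> facets n P \<and> H \<in> facets n P \<and> F \<noteq> H \<and>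
         (\<exists>\<Phi>\<in>flags F. \<exists>\<Psi>\<in>flags H. {\<Phi>, \<Psi>} \<in> edges P (n - 1))})"

datatype hue = Red | Blue

definition proper_2_coloring :: "'v set \<times> 'v set set \<Rightarrow> ('v \<Rightarrow> hue) \<Rightarrow> bool" where
  "proper_2_coloring \<Gamma> f \<longleftrightarrow>
     (\<forall>u\<in>fst \<Gamma>. \<forall>v\<in>fst \<Gamma>. {u, v} \<in> snd \<Gamma> \<longrightarrow> f u \<noteq> f v)"

definition bipartite :: "'v set \<times> 'v set set \<Rightarrow> bool" where
  "bipartite \<Gamma> \<longleftrightarrow> (\<exists>f. proper_2_coloring \<Gamma> f)"

definition facet_bipartite :: "nat \<Rightarrow> 'a cgraph \<Rightarrow> bool" where
  "facet_bipartite n P \<longleftrightarrow> bipartite (facet_graph n P)"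

definition flag_hue :: "nat \<Rightarrow> 'a cgraph \<Rightarrow> ('a cgraph \<Rightarrow> hue) \<Rightarrow> 'a \<Rightarrow> hue" where
  "flag_hue n P f \<Phi> = f (THE F. F \<in> facets n P \<and> \<Phi> \<in> flags F)"

text \<open>
  \<open>layered n P f k\<close> is the graph \<open>P|k\<close> built from the coloring \<open>f\<close> of the facets; the pair
  \<open>(\<Phi>, l)\<close> is the copy of the flag \<open>\<Phi>\<close> in layer \<open>l \<in> {1..k}\<close>.  The layer after \<open>l\<close> is
  \<open>l mod k + 1\<close>, that is, \<open>l + 1\<close> for \<open>l < k\<close> and \<open>1\<close> for \<open>l = k\<close>.
\<close>

definition layered ::
  "nat \<Rightarrow> 'a cgraph \<Rightarrow> ('a cgraph \<Rightarrow> hue) \<Rightarrow> nat \<Rightarrow> ('a \<times> nat) cgraph" where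
  "layered n P f k =
     \<lparr>flags = flags P \<times> {1..k},
      edges = (\<lambda>c.
        if c < n then
          {{(\<Phi>, l), (\<Psi>, l)} |\<Phi> \<Psi> l. {\<Phi>, \<Psi>} \<in> edges P c \<and> l \<in> {1..k}}
        else if c = n then
          {{(\<Phi>, l), (\<Phi>, l mod k + 1)} |\<Phi> l.
             \<Phi> \<in> flags P \<and> flag_hue n P f \<Phi> = Red \<and> l \<in> {1..k} \<and> odd l} \<union>
          {{(\<Psi>, l), (\<Psi>, l mod k + 1)} |\<Psi> l.
             \<Psi> \<in> flags P \<and> flag_hue n P f \<Psi> = Blue \<and> l \<in> {1..k} \<and> even l}
        else {})\<rparr>"

end

theory Submission
  imports Defs
begin

text \<open>
  The color-\<open>n\<close> edges of \<open>P|k\<close> project to single flags of \<open>P\<close>, and all other edges stay in one layer.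
  So paths avoiding color \<open>n\<close> are paths of \<open>P\<close> inside a layer, and the Path Intersection
  Property is inherited from \<open>P\<close>.  Since \<open>\<Phi>\<close> and \<open>\<Phi>\<^sup>n\<^sup>-\<^sup>1\<close> lie in distinct facets, hence have different
  hues, alternating the colors \<open>n - 1\<close> and \<open>n\<close> runs through all layers; this yields
  connectedness and flatness.
\<close>

section \<open>Colored graphs given by involutions\<close>

lemma nbr_eq_iff:
  assumes G: "pre_maniplex n G" and c: "c < n" and x: "x \<in> flags G"
  shows "{x, y} \<in> edges G c \<longleftrightarrow> y = nbr G c x"
proof -
  obtain e where e: "e \<in> edges G c" "x \<in> e"
      and u: "\<And>e'. e' \<in> edges G c \<Longrightarrow> x \<in> e' \<Longrightarrow> e' = e"
    using G c x unfolding pre_maniplex_def by metis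
  have "card e = 2"
    using G e(1) unfolding pre_maniplex_def by blast
  then obtain z where z: "e = {x, z}" "z \<noteq> x"
    using e(2) by (auto simp: card_2_iff)
  have iff: "{x, y} \<in> edges G c \<longleftrightarrow> y = z" for y
    using u[of "{x, y}"] e z by (auto simp: doubleton_eq_iff)
  then have "nbr G c x = z"
    unfolding nbr_def by simp
  then show ?thesis using iff by simp
qed

lemma edge_color_less: "pre_maniplex n G \<Longrightarrow> e \<in> edges G c \<Longrightarrow> c < n"
  unfolding pre_maniplex_def by blast

lemma edge_flags: "pre_maniplex n G \<Longrightarrow> {x, y} \<in> edges G c \<Longrightarrow> x \<in> flags G \<and> y \<in> flags G"
  unfolding pre_maniplex_def by (metis insert_subset)

lemma nbr_props:
  assumes G: "pre_maniplex n G" and c: "c < n" and x: "x \<in> flags G"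
  shows nbr_edge: "{x, nbr G c x} \<in> edges G c"
    and nbr_flag: "nbr G c x \<in> flags G"
    and nbr_neq: "nbr G c x \<noteq> x"
    and nbr_nbr: "nbr G c (nbr G c x) = x"
proof -
  show e: "{x, nbr G c x} \<in> edges G c"
    using nbr_eq_iff[OF assms] by simp
  then show f: "nbr G c x \<in> flags G"
    using edge_flags[OF G] by blast
  have "card {x, nbr G c x} = 2"
    using G e unfolding pre_maniplex_def by blast
  then show "nbr G c x \<noteq> x" by auto
  show "nbr G c (nbr G c x) = x"
    using e nbr_eq_iff[OF G c f, of x] by (simp add: insert_commute)
qed

lemma nbr_inj_color:
  assumes G: "pre_maniplex n G" and "c < n" "d < n" "x \<in> flags G" "nbr G c x = nbr G d x"
  shows "c = d"
  using nbr_edge[OF G, of c x] nbr_edge[OF G, of d x] assms unfolding pre_maniplex_def by metis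

lemma edges_eq_nbr:
  assumes G: "pre_maniplex n G" and c: "c < n"
  shows "edges G c = (\<lambda>x. {x, nbr G c x}) ` flags G"
proof
  show "edges G c \<subseteq> (\<lambda>x. {x, nbr G c x}) ` flags G"
  proof
    fix e assume e: "e \<in> edges G c"
    then have "card e = 2" "e \<subseteq> flags G"
      using G unfolding pre_maniplex_def by blast+
    then obtain x y where xy: "e = {x, y}" "x \<in> flags G"
      by (auto simp: card_2_iff)
    then have "y = nbr G c x"
      using nbr_eq_iff[OF G c, of x y] e by simp
    then show "e \<in> (\<lambda>x. {x, nbr G c x}) ` flags G"
      using xy by simp
  qed
qed (use nbr_edge[OF assms] in blast)

text \<open>Criterion for \<open>P|k\<close>: \<open>inv\<close> makes the edge of each color at a
  flag unique, \<open>neq\<close> gives it two endpoints, and \<open>inj\<close> excludes parallel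
  edges.\<close>

lemma involutions_pre_maniplex:
  assumes n: "n \<ge> 1"
    and edges: "\<And>c. c < n \<Longrightarrow> edges G c = (\<lambda>x. {x, s c x}) ` flags G"
    and empty: "\<And>c. c \<ge> n \<Longrightarrow> edges G c = {}"
    and closed: "\<And>c x. c < n \<Longrightarrow> x \<in> flags G \<Longrightarrow> s c x \<in> flags G"
    and neq: "\<And>c x. c < n \<Longrightarrow> x \<in> flags G \<Longrightarrow> s c x \<noteq> x"
    and inv: "\<And>c x. c < n \<Longrightarrow> x \<in> flags G \<Longrightarrow> s c (s c x) = x"
    and inj: "\<And>c d x. c < n \<Longrightarrow> d < n \<Longrightarrow> x \<in> flags G \<Longrightarrow> s c x = s d x \<Longrightarrow> c = d"
  shows "pre_maniplex n G"
proof -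
  have less: "c < n" if "e \<in> edges G c" for c e
    using empty[of c] that by fastforce
  have obt: "\<exists>x\<in>flags G. e = {x, s c x}" if "e \<in> edges G c" for c e
    using edges[OF less[OF that]] that by blast
  show ?thesis
    unfolding pre_maniplex_def
  proof (intro conjI allI impI ballI)
    fix c e assume e: "e \<in> edges G c"
    then obtain x where x: "x \<in> flags G" "e = {x, s c x}" using obt by blast
    show "c < n" using less e .
    then show "e \<subseteq> flags G" "card e = 2" using x closed neq[of c x] by auto
  next
    fix c d e assume e: "e \<in> edges G c \<and> e \<in> edges G d"
    obtain x y where x: "x \<in> flags G" "e = {x, s c x}" and y: "y \<in> flags G" "e = {y, s d y}"
      using obt e by meson
    have cd: "c < n" "d < n" using less e by blast+
    \<comment> \<open>The flag \<open>x\<close> is \<open>y\<close> or \<open>s d y\<close>, and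
      since \<open>s d\<close> is an involution the edge reads the same from either end.\<close>
    have "e = {x, s d x}"
      using x y inv[of d y] cd neq[of c x] by (auto simp: doubleton_eq_iff)
    then have "s c x = s d x" using x(2) by (metis doubleton_eq_iff)
    then show "c = d" using inj cd x(1) by blast
  next
    fix c x assume c: "c < n" and x: "x \<in> flags G"
    show "\<exists>!e. e \<in> edges G c \<and> x \<in> e"
    proof
      show "{x, s c x} \<in> edges G c \<and> x \<in> {x, s c x}" using edges[OF c] x by blast
      fix e assume "e \<in> edges G c \<and> x \<in> e"
      then show "e = {x, s c x}" using obt inv[OF c] by fastforce
    qed
  qed (fact n)
qed

section \<open>Linked flags and faces\<close>

lemma linked_refl [simp]: "(x, x) \<in> linked G C"
  unfolding linked_def by simp

lemma linked_trans: "(x, y) \<in> linked G C \<Longrightarrow> (y, z) \<in> linked G C \<Longrightarrow> (x, z) \<in> linked G C"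
  unfolding linked_def by (rule rtrancl_trans)

lemma linked_sym: "(x, y) \<in> linked G C \<Longrightarrow> (y, x) \<in> linked G C"
  unfolding linked_def
  by (rule symD[OF sym_rtrancl]) (auto simp: sym_def insert_commute)

lemma linked_edge: "{x, y} \<in> edges G c \<Longrightarrow> c \<in> C \<Longrightarrow> (x, y) \<in> linked G C"
  unfolding linked_def by (rule r_into_rtrancl) blast

lemma linked_mono: "(x, y) \<in> linked G C \<Longrightarrow> C \<subseteq> D \<Longrightarrow> (x, y) \<in> linked G D"
  unfolding linked_def by (erule rtrancl_mono[THEN subsetD, rotated]) blast

lemma linked_induct [consumes 1, case_names refl step]:
  assumes "(x, y) \<in> linked G C" and "Q x"
    and "\<And>y z c. (x, y) \<in> linked G C \<Longrightarrow> c \<in> C \<Longrightarrow> {y, z} \<in> edges G c \<Longrightarrow> Q y \<Longrightarrow> Q z"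
  shows "Q y"
  using assms(1) unfolding linked_def
proof (induction rule: rtrancl_induct)
  case (step y z)
  then show ?case using assms(3)[of y _ z] unfolding linked_def by blast
qed (fact assms(2))

lemma linked_flags:
  assumes G: "pre_maniplex n G" and "(x, y) \<in> linked G C" and "x \<in> flags G"
  shows "y \<in> flags G"
  using assms(2,3)
proof (induction rule: linked_induct)
  case (step y z c)
  then show ?case using edge_flags[OF G] by blast
qed

text \<open>Faces allow all natural numbers but one as colors, whereas path intersection speaks of
  intervals below \<open>n\<close>; cutting off the colors that carry no edge bridges the
  two.\<close>

lemma linked_restrict:
  assumes G: "pre_maniplex n G" and "(x, y) \<in> linked G C"
  shows "(x, y) \<in> linked G (C \<inter> {..<n})"
  using assms(2)
proof (induction rule: linked_induct)
  case (step y z c)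
  have "(y, z) \<in> linked G (C \<inter> {..<n})"
    using step(2) edge_color_less[OF G step(3)] by (intro linked_edge[OF step(3)]) simp
  then show ?case by (rule linked_trans[OF step(4)])
qed simp

lemma linked_singleton:
  assumes G: "pre_maniplex n G" and c: "c < n" and x: "x \<in> flags G"
    and "(x, y) \<in> linked G {c}"
  shows "y = x \<or> y = nbr G c x"
  using assms(4)
proof (induction rule: linked_induct)
  case (step y z d)
  then have "y \<in> flags G" "z = nbr G c y"
    using edge_flags[OF G, of y z c] nbr_eq_iff[OF G c, of y z] by auto
  then show ?case using step(4) nbr_nbr[OF G c x] by blast
qed simp

lemma linked_class_eq: "(x, y) \<in> linked G C \<Longrightarrow> linked G C `` {x} = linked G C `` {y}"
  using linked_trans[of x y G C] linked_trans[of y x G C] linked_sym[of x y G C] by blast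

lemma linked_delete_color: "linked (delete_color i G) UNIV = linked G {c. int c \<noteq> i}"
  unfolding linked_def delete_color_def by (rule arg_cong[of _ _ rtrancl]) auto

section \<open>The face through a flag\<close>

definition face_of :: "int \<Rightarrow> 'a cgraph \<Rightarrow> 'a \<Rightarrow> 'a cgraph" where
  "face_of i G x = induced (delete_color i G) (linked G {c. int c \<noteq> i} `` {x})"

lemma flags_induced [simp]: "flags (induced G X) = X"
  unfolding induced_def by simp

lemma flags_face_of: "flags (face_of i G x) = linked G {c. int c \<noteq> i} `` {x}"
  unfolding face_of_def by simp

lemma faces_eq: "faces i G = face_of i G ` flags G"
  unfolding faces_def components_def quotient_def linked_delete_color face_of_def
  by (auto simp: delete_color_def)

lemma face_of_eq_iff: "face_of i G x = face_of i G y \<longleftrightarrow> (x, y) \<in> linked G {c. int c \<noteq> i}"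
proof
  assume "face_of i G x = face_of i G y"
  then have "flags (face_of i G x) = flags (face_of i G y)" by simp
  then show "(x, y) \<in> linked G {c. int c \<noteq> i}"
    unfolding flags_face_of by auto
next
  assume "(x, y) \<in> linked G {c. int c \<noteq> i}"
  then show "face_of i G x = face_of i G y"
    unfolding face_of_def by (simp add: linked_class_eq)
qed

text \<open>Faces of one index are classes of an equivalence relation, so a flag lies in exactly one
  facet and the description in \<open>flag_hue\<close> is well defined.\<close>

lemma flag_hue_eq:
  assumes "x \<in> flags P"
  shows "flag_hue n P f x = f (face_of (int n - 1) P x)"
proof -
  have "(THE F. F \<in> facets n P \<and> x \<in> flags F) = face_of (int n - 1) P x"
  proof (rule the_equality)
    show "face_of (int n - 1) P x \<in> facets n P \<and> x \<in> flags (face_of (int n - 1) P x)"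
      using assms unfolding facets_def faces_eq flags_face_of by auto
    fix F assume F: "F \<in> facets n P \<and> x \<in> flags F"
    then obtain y where "F = face_of (int n - 1) P y"
      unfolding facets_def faces_eq by blast
    with F show "F = face_of (int n - 1) P x"
      by (auto simp: flags_face_of face_of_eq_iff)
  qed
  then show ?thesis unfolding flag_hue_def by simp
qed

lemma path_intersectionD:
  assumes "path_intersection_property n G" "x \<in> flags G" "y \<in> flags G" "i \<le> j" "j < n"
    and "(x, y) \<in> linked G {i..n - 1}" "(x, y) \<in> linked G {0..j}"
  shows "(x, y) \<in> linked G {i..j}"
  using assms unfolding path_intersection_property_def by blast

text \<open>Otherwise a path with colors up to \<open>n - 2\<close> would join \<open>x\<close> to
  its neighbor; path intersection with the edge of color \<open>n - 1\<close> would leave color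
  \<open>n - 2\<close> alone, giving two parallel edges.\<close>

lemma polytope_nbr_last_face:
  assumes "polytope n P" and x: "x \<in> flags P" and n: "n \<ge> 1"
  shows "face_of (int n - 1) P (nbr P (n - 1) x) \<noteq> face_of (int n - 1) P x"
proof
  let ?y = "nbr P (n - 1) x"
  have G: "pre_maniplex n P" and pip: "path_intersection_property n P"
    using assms(1) unfolding polytope_def maniplex_def by auto
  have last: "n - 1 < n" using n by simp
  note y = nbr_edge[OF G last x] nbr_flag[OF G last x] nbr_neq[OF G last x]
  assume "face_of (int n - 1) P ?y = face_of (int n - 1) P x"
  then have "(x, ?y) \<in> linked P {c. int c \<noteq> int n - 1}"
    by (simp only: face_of_eq_iff linked_sym)
  then have l: "(x, ?y) \<in> linked P ({c. int c \<noteq> int n - 1} \<inter> {..<n})"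
    by (rule linked_restrict[OF G])
  \<comment> \<open>For \<open>n = 1\<close>, natural subtraction would turn \<open>n - 2\<close>
    into color 0; in that case no color remains and the path is empty.\<close>
  show False
  proof (cases "n = 1")
    case True
    then have "{c. int c \<noteq> int n - 1} \<inter> {..<n} = {}" by auto
    then show False using l y(3) by (simp add: linked_def)
  next
    case False
    then have n2: "n \<ge> 2" using n by simp
    have "(x, ?y) \<in> linked P {0..n - 2}"
      using l by (rule linked_mono) auto
    moreover have "(x, ?y) \<in> linked P {n - 2..n - 1}"
      using y(1) by (rule linked_edge) auto
    \<comment> \<open>Both ends of the window are taken as \<open>n - 2\<close>, the only color
      common to the two ranges.\<close>
    ultimately have "(x, ?y) \<in> linked P {n - 2..n - 2}"
      using path_intersectionD[OF pip x y(2), of "n - 2" "n - 2"] n2 by simp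
    then have "?y = nbr P (n - 2) x"
      using linked_singleton[OF G _ x, of "n - 2" ?y] y(3) n2 by auto
    then show False
      using nbr_inj_color[OF G, of "n - 1" "n - 2" x] x n2 by auto
  qed
qed

section \<open>The layered graph\<close>

text \<open>\<open>layered\<close> lists each edge of color \<open>n\<close> from one endpoint only.
  The first branch goes forward from that endpoint, the second comes back from the other, with layer
  1 returning to \<open>k\<close>.\<close>

definition next_layer :: "nat \<Rightarrow> hue \<Rightarrow> nat \<Rightarrow> nat" where
  "next_layer k h l =
     (if (h = Red) = odd l then l mod k + 1 else if l = 1 then k else l - 1)"

text \<open>Since \<open>k\<close> is even, the wrap between layers \<open>k\<close> and 1 also
  changes parity. A second application therefore takes the other branch and undoes the first;
  \<open>k\<close> is at least 2, so no layer is fixed.\<close>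

lemma next_layer_props:
  assumes "even k" "k > 0" "l \<in> {1..k}"
  shows next_layer_mem: "next_layer k h l \<in> {1..k}"
    and next_layer_neq: "next_layer k h l \<noteq> l"
    and next_layer_parity: "odd (next_layer k h l) \<longleftrightarrow> even l"
    and next_layer_inv: "next_layer k h (next_layer k h l) = l"
proof -
  have k: "k \<ge> 2" using assms(1,2) by (auto elim!: evenE)
  have m: "l mod k = (if l = k then 0 else l)" using assms(3) by auto
  show mem: "next_layer k h l \<in> {1..k}"
    using assms(3) k m unfolding next_layer_def by auto
  show "next_layer k h l \<noteq> l"
    using assms(3) k m unfolding next_layer_def by auto
  show par: "odd (next_layer k h l) \<longleftrightarrow> even l"
    using assms k m unfolding next_layer_def by auto
  show "next_layer k h (next_layer k h l) = l"
  proof (cases "(h = Red) = odd l")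
    case True
    then have "next_layer k h l = l mod k + 1" unfolding next_layer_def by simp
    moreover have "(h = Red) \<noteq> odd (next_layer k h l)" using par True by blast
    ultimately show ?thesis unfolding next_layer_def[of k h "next_layer k h l"]
      using m assms(3) by auto
  next
    case False
    then have "next_layer k h l = (if l = 1 then k else l - 1)" unfolding next_layer_def by simp
    moreover have "(h = Red) = odd (next_layer k h l)" using par False by blast
    ultimately show ?thesis unfolding next_layer_def[of k h "next_layer k h l"]
      using assms(3) by auto
  qed
qed

section \<open>Neighbors and hues in \<open>P|k\<close>\<close>

locale layering =
  fixes n k :: nat and P :: "'a cgraph" and f :: "'a cgraph \<Rightarrow> hue"
  assumes n: "n \<ge> 1" and poly: "polytope n P"
    and k: "even k" "k > 0"
    and col: "proper_2_coloring (facet_graph n P) f"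
begin

abbreviation "L \<equiv> layered n P f k"
abbreviation "hue_of \<equiv> flag_hue n P f"

definition layer_nbr :: "nat \<Rightarrow> 'a \<times> nat \<Rightarrow> 'a \<times> nat" where
  "layer_nbr c x = (if c < n then (nbr P c (fst x), snd x)
     else (fst x, next_layer k (hue_of (fst x)) (snd x)))"

lemma pre: "pre_maniplex n P" and man: "maniplex n P" and pip: "path_intersection_property n P"
  using poly unfolding polytope_def maniplex_def by auto

lemma flags_L [simp]: "flags L = flags P \<times> {1..k}"
  unfolding layered_def by simp

text \<open>The facets of \<open>x\<close> and of its neighbor are distinct by
  \<open>polytope_nbr_last_face\<close>, hence adjacent in the facet graph, and a proper coloring
  separates them.\<close>

lemma hue_nbr_last:
  assumes x: "x \<in> flags P"
  shows "hue_of (nbr P (n - 1) x) \<noteq> hue_of x"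
proof -
  let ?y = "nbr P (n - 1) x" and ?F = "face_of (int n - 1) P"
  have last: "n - 1 < n" using n by simp
  note y = nbr_edge[OF pre last x] nbr_flag[OF pre last x]
  have F: "?F x \<in> facets n P" "?F ?y \<in> facets n P"
    using x y(2) unfolding facets_def faces_eq by auto
  moreover have "x \<in> flags (?F x)" "?y \<in> flags (?F ?y)"
    unfolding flags_face_of by auto
  ultimately have "{?F x, ?F ?y} \<in> snd (facet_graph n P)"
    using y(1) polytope_nbr_last_face[OF poly x n] unfolding facet_graph_def snd_conv mem_Collect_eq
    by (intro exI[of _ "?F x"] exI[of _ "?F ?y"]) auto
  then have "f (?F x) \<noteq> f (?F ?y)"
    using col F unfolding proper_2_coloring_def facet_graph_def by simp
  then show ?thesis using x y(2) by (simp add: flag_hue_eq)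
qed

text \<open>An edge of color other than \<open>n - 1\<close> stays in its facet. Hence color
  \<open>n\<close> will commute with the colors below \<open>n - 1\<close>.\<close>

lemma hue_nbr:
  assumes x: "x \<in> flags P" and c: "c < n" "c \<noteq> n - 1"
  shows "hue_of (nbr P c x) = hue_of x"
proof -
  have "(x, nbr P c x) \<in> linked P {c. int c \<noteq> int n - 1}"
    using nbr_edge[OF pre c(1) x] by (rule linked_edge) (use c in auto)
  then have "face_of (int n - 1) P x = face_of (int n - 1) P (nbr P c x)"
    by (simp only: face_of_eq_iff)
  then show ?thesis using x nbr_flag[OF pre c(1) x] by (simp add: flag_hue_eq)
qed

lemma edges_L:
  assumes "c < n + 1"
  shows "edges L c = (\<lambda>x. {x, layer_nbr c x}) ` flags L"
proof (cases "c < n")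
  case True
  have "edges L c = {{(x, l), (y, l)} |x y l. {x, y} \<in> edges P c \<and> l \<in> {1..k}}"
    using True unfolding layered_def by simp
  also have "\<dots> = {{(x, l), (nbr P c x, l)} |x l. x \<in> flags P \<and> l \<in> {1..k}}"
  proof -
    have "{x, y} \<in> edges P c \<longleftrightarrow> x \<in> flags P \<and> y = nbr P c x" for x y
      using edge_flags[OF pre, of x y c] nbr_eq_iff[OF pre True, of x y] by blast
    then show ?thesis by auto
  qed
  also have "\<dots> = (\<lambda>x. {x, layer_nbr c x}) ` flags L"
    using True unfolding layer_nbr_def by force
  finally show ?thesis .
next
  case False
  then have c: "c = n" using assms by simp
  let ?s = "\<lambda>x l. next_layer k (hue_of x) l"
  let ?A = "{{(x, l), (x, l mod k + 1)} |x l. x \<in> flags P \<and> hue_of x = Red \<and> l \<in> {1..k} \<and> odd l}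
    \<union> {{(x, l), (x, l mod k + 1)} |x l. x \<in> flags P \<and> hue_of x = Blue \<and> l \<in> {1..k} \<and> even l}"
  let ?B = "{{(x, l), (x, ?s x l)} |x l. x \<in> flags P \<and> l \<in> {1..k}}"
  have blue: "h = Blue \<longleftrightarrow> h \<noteq> Red" for h by (cases h) auto
  \<comment> \<open>A red flag steps forward from odd layers and a blue one from even layers; both
    conditions read \<open>(hue_of x = Red) = odd l\<close>, the first branch of
    \<open>next_layer\<close>.\<close>
  have "?A = {{(x, l), (x, ?s x l)} |x l.
      x \<in> flags P \<and> l \<in> {1..k} \<and> (hue_of x = Red) = odd l}" (is "_ = ?C")
    unfolding blue next_layer_def by (safe; simp; metis)
  also have "?C = ?B"
  proof
    show "?B \<subseteq> ?C"
    proof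
      fix e assume "e \<in> ?B"
      then obtain x l where e: "e = {(x, l), (x, ?s x l)}" "x \<in> flags P" "l \<in> {1..k}" by blast
      show "e \<in> ?C"
      proof (cases "(hue_of x = Red) = odd l")
        \<comment> \<open>In the second branch the edge is read from its other endpoint, where the
          parity is opposite and the first branch applies.\<close>
        case False
        note p = next_layer_props[OF k e(3), of "hue_of x"]
        have "e = {(x, ?s x l), (x, ?s x (?s x l))}" using e(1) p(4) by (simp add: insert_commute)
        moreover have "(hue_of x = Red) = odd (?s x l)" using p(3) False by blast
        ultimately show ?thesis using e(2) p(1) by blast
      qed (use e in blast)
    qed
  qed blast
  also have "?B = (\<lambda>x. {x, layer_nbr c x}) ` flags L"
    using c unfolding layer_nbr_def by force
  finally show ?thesis using c unfolding layered_def by simp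
qed

text \<open>Color \<open>n\<close> changes the layer and the other colors preserve it, so parallel
  edges could only arise inside a layer, where \<open>P\<close> excludes them.\<close>

lemma pre_L: "pre_maniplex (n + 1) L"
proof (rule involutions_pre_maniplex[where s = layer_nbr])
  fix c x assume c: "c < n + 1" and x: "x \<in> flags L"
  show "layer_nbr c x \<in> flags L" "layer_nbr c x \<noteq> x" "layer_nbr c (layer_nbr c x) = x"
    using x nbr_props[OF pre, of c "fst x"] next_layer_props[OF k, of "snd x" "hue_of (fst x)"]
    by (cases x; auto simp: layer_nbr_def)+
next
  fix c d x assume "c < n + 1" "d < n + 1" "x \<in> flags L" "layer_nbr c x = layer_nbr d x"
  then show "c = d"
    using nbr_inj_color[OF pre, of c d "fst x"] next_layer_neq[OF k, of "snd x"]
      nbr_neq[OF pre, of _ "fst x"]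
    by (cases x) (auto simp: layer_nbr_def split: if_splits)
qed (use edges_L in \<open>auto simp: layered_def\<close>)

lemma nbr_L:
  assumes "c < n + 1" "x \<in> flags L"
  shows "nbr L c x = layer_nbr c x"
proof -
  have "{x, layer_nbr c x} \<in> edges L c"
    unfolding edges_L[OF assms(1)] using assms(2) by (rule imageI)
  then show ?thesis using nbr_eq_iff[OF pre_L assms] by simp
qed

lemma edge_L_iff:
  assumes "x \<in> flags L"
  shows "{x, y} \<in> edges L c \<longleftrightarrow> c < n + 1 \<and> y = layer_nbr c x"
  using nbr_eq_iff[OF pre_L _ assms, of c y] nbr_L[OF _ assms, of c]
    edge_color_less[OF pre_L, of "{x, y}" c] by auto

section \<open>Lifting paths of \<open>P\<close> and projecting paths of \<open>P|k\<close>\<close>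

lemma linked_lift:
  assumes "(x, y) \<in> linked P C" and x: "x \<in> flags P" and l: "l \<in> {1..k}"
  shows "((x, l), (y, l)) \<in> linked L (C - {n})"
  using assms(1)
proof (induction rule: linked_induct)
  case (step y z c)
  \<comment> \<open>Edges of \<open>P\<close> have colors below \<open>n\<close>, so
    \<open>n\<close> can be removed from \<open>C\<close> in the lift.\<close>
  have c: "c < n" using edge_color_less[OF pre step(3)] .
  have y: "y \<in> flags P" using linked_flags[OF pre step(1) x] .
  have "{(y, l), (z, l)} \<in> edges L c"
    using step(3) y l c nbr_eq_iff[OF pre c y] by (simp add: edge_L_iff layer_nbr_def)
  then have "((y, l), (z, l)) \<in> linked L (C - {n})"
    using step(2) c by (intro linked_edge[of _ _ _ c]) auto
  then show ?case by (rule linked_trans[OF step(4)])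
qed simp

text \<open>Edges of color \<open>n\<close> collapse to single flags of \<open>P\<close>, and all
  other edges project to edges of \<open>P\<close> and preserve the layer.\<close>

lemma linked_project:
  assumes "(x, y) \<in> linked L C" and x: "x \<in> flags L"
  shows "(fst x, fst y) \<in> linked P (C - {n}) \<and> (n \<notin> C \<longrightarrow> snd y = snd x)"
  using assms(1)
proof (induction rule: linked_induct)
  case (step y z c)
  have y: "y \<in> flags L" using linked_flags[OF pre_L step(1) x] .
  then have z: "c < n + 1" "z = layer_nbr c y" using step(3) edge_L_iff by auto
  show ?case
  proof (cases "c < n")
    case True
    have "(fst y, fst z) \<in> linked P (C - {n})"
      using nbr_edge[OF pre True, of "fst y"] y z True step(2)
      by (intro linked_edge[of _ _ _ c]) (auto simp: layer_nbr_def)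
    then show ?thesis
      using step(4) z True by (auto simp: layer_nbr_def intro: linked_trans)
  next
    case False
    then show ?thesis using step(4,2) z by (auto simp: layer_nbr_def less_Suc_eq)
  qed
qed simp

section \<open>Reaching every layer with colors \<open>n - 1\<close> and \<open>n\<close>\<close>

lemma linked_next_layer:
  assumes x: "x \<in> flags P" and l: "l \<in> {1..k}"
  shows "\<exists>y. ((x, l), (y, l mod k + 1)) \<in> linked L {n - 1, n}"
proof -
  have up: "((y, l), (y, l mod k + 1)) \<in> linked L {n - 1, n}"
    if "y \<in> flags P" "(hue_of y = Red) = odd l" for y
    using that l by (intro linked_edge[of _ _ _ n]) (auto simp: edge_L_iff layer_nbr_def next_layer_def)
  show ?thesis
  proof (cases "(hue_of x = Red) = odd l")
    case True
    then show ?thesis using up x by blast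
  next
    \<comment> \<open>Here color \<open>n\<close> would lead backward from \<open>x\<close>.
      Crossing the edge of color \<open>n - 1\<close> first stays in the layer and switches the
      hue.\<close>
    case False
    have last: "n - 1 < n" using n by simp
    let ?y = "nbr P (n - 1) x"
    have "hue_of ?y \<noteq> hue_of x" using hue_nbr_last[OF x] .
    then have "(hue_of ?y = Red) = odd l"
      using False by (cases "hue_of x"; cases "hue_of ?y") auto
    then have "((?y, l), (?y, l mod k + 1)) \<in> linked L {n - 1, n}"
      using up nbr_flag[OF pre last x] by blast
    moreover have "((x, l), (?y, l)) \<in> linked L {n - 1, n}"
      using x l last by (intro linked_edge[of _ _ _ "n - 1"]) (auto simp: edge_L_iff layer_nbr_def)
    ultimately show ?thesis using linked_trans by metis
  qed
qed

lemma linked_every_layer: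
  assumes x: "x \<in> flags P" and l: "l \<in> {1..k}" and m: "m \<in> {1..k}"
  shows "\<exists>y\<in>flags P. ((x, l), (y, m)) \<in> linked L {n - 1, n}"
proof -
  \<comment> \<open>Layers are counted from 0 inside \<open>mod\<close> and shifted back by 1;
    \<open>d\<close> is the number of forward moves.\<close>
  have ex: "\<exists>y. ((x, l), (y, (l - 1 + d) mod k + 1)) \<in> linked L {n - 1, n}" for d
  proof (induction d)
    case 0
    have "(l - 1) mod k + 1 = l" using l by auto
    then show ?case by (metis add_0_right linked_refl)
  next
    case (Suc d)
    let ?m = "(l - 1 + d) mod k + 1"
    from Suc obtain y where y: "((x, l), (y, ?m)) \<in> linked L {n - 1, n}" by blast
    have "y \<in> flags P" "?m \<in> {1..k}" using linked_flags[OF pre_L y] x l by auto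
    then obtain z where "((y, ?m), (z, ?m mod k + 1)) \<in> linked L {n - 1, n}"
      using linked_next_layer by blast
    moreover have "?m mod k + 1 = (l - 1 + Suc d) mod k + 1" by (simp add: mod_simps)
    ultimately show ?case using y linked_trans by metis
  qed
  \<comment> \<open>The number of moves \<open>m + k - l\<close> is congruent to
    \<open>m - l\<close> modulo \<open>k\<close>; adding \<open>k\<close> keeps natural subtraction
    from truncating.\<close>
  have "l - 1 + (m + k - l) = (m - 1) + k" using l m by auto
  then have "(l - 1 + (m + k - l)) mod k = (m - 1) mod k" by (simp only: mod_add_self2)
  also have "\<dots> = m - 1" using m by (intro mod_less) auto
  finally have "(l - 1 + (m + k - l)) mod k + 1 = m" using m by simp
  then obtain y where y: "((x, l), (y, m)) \<in> linked L {n - 1, n}"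
    using ex[of "m + k - l"] by metis
  then show ?thesis using linked_flags[OF pre_L y] x l by auto
qed

section \<open>\<open>P|k\<close> is an \<open>(n + 1)\<close>-polytope\<close>

lemma linked_P: "x \<in> flags P \<Longrightarrow> y \<in> flags P \<Longrightarrow> (x, y) \<in> linked P UNIV"
  using man unfolding maniplex_def connected_cgraph_def by blast

lemma flags_P_nonempty: "flags P \<noteq> {}"
  using man unfolding maniplex_def connected_cgraph_def by blast

text \<open>The layer is adjusted first with colors \<open>n - 1\<close> and \<open>n\<close>; a
  lifted path of \<open>P\<close> then reaches the target inside its layer.\<close>

lemma connected_L: "connected_cgraph L"
  unfolding connected_cgraph_def
proof (intro conjI ballI)
  show "flags L \<noteq> {}" using flags_P_nonempty k by auto
  fix x y assume x: "x \<in> flags L" and y: "y \<in> flags L"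
  then obtain z where z: "z \<in> flags P" "((fst x, snd x), (z, snd y)) \<in> linked L {n - 1, n}"
    using linked_every_layer[of "fst x" "snd x" "snd y"] by auto
  have "((z, snd y), (fst y, snd y)) \<in> linked L (UNIV - {n})"
    using linked_lift[OF linked_P] z(1) y by auto
  with z(2) show "(x, y) \<in> linked L UNIV"
    using linked_trans linked_mono[OF _ subset_UNIV] by (metis prod.collapse)
qed

text \<open>Two distant colors below \<open>n\<close> commute because they do in \<open>P\<close>.
  If one color is \<open>n\<close>, the other is at most \<open>n - 2\<close> and so preserves the
  hue that decides the layer change.\<close>

lemma maniplex_L: "maniplex (n + 1) L"
  unfolding maniplex_def
proof (intro conjI ballI allI impI)
  fix x i j assume x: "x \<in> flags L" and ij: "i < n + 1" "j < n + 1" "\<bar>int i - int j\<bar> > 1"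
  have x': "fst x \<in> flags P" "snd x \<in> {1..k}" using x by auto
  have nb: "nbr L i (nbr L j x) = layer_nbr i (layer_nbr j x)" if "i < n + 1" "j < n + 1" for i j
    using nbr_L that x nbr_flag[OF pre_L that(2) x] by metis
  have comm: "nbr P j (nbr P i (fst x)) = nbr P i (nbr P j (fst x))" if "i < n" "j < n"
    using man x' ij that unfolding maniplex_def by blast
  show "nbr L j (nbr L i x) = nbr L i (nbr L j x)"
    using ij comm hue_nbr[OF x'(1)] unfolding nb[OF ij(1,2)] nb[OF ij(2,1)]
    by (auto simp: layer_nbr_def)
qed (fact pre_L connected_L)+

text \<open>For \<open>j < n\<close> the lower path avoids color \<open>n\<close> and stays in one
  layer. Both paths project to \<open>P\<close>, whose path intersection gives a path that lifts
  back into this layer.\<close>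

lemma path_intersection_L: "path_intersection_property (n + 1) L"
  unfolding path_intersection_property_def
proof (intro ballI allI impI)
  fix x y i j
  assume x: "x \<in> flags L" and y: "y \<in> flags L" and ij: "i \<le> j \<and> j < n + 1"
    and up: "(x, y) \<in> linked L {i..n + 1 - 1}" and down: "(x, y) \<in> linked L {0..j}"
  show "(x, y) \<in> linked L {i..j}"
  proof (cases "j = n")
    case True
    then show ?thesis using up by simp
  next
    case False
    then have j: "j < n" using ij by simp
    have "(fst x, fst y) \<in> linked P {i..n - 1}"
      by (rule linked_mono[OF linked_project[OF up x, THEN conjunct1]]) auto
    moreover have "(fst x, fst y) \<in> linked P {0..j}"
      by (rule linked_mono[OF linked_project[OF down x, THEN conjunct1]]) auto
    ultimately have "(fst x, fst y) \<in> linked P {i..j}"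
      using path_intersectionD[OF pip _ _ _ j, of "fst x" "fst y" i] x y ij by auto
    then have "((fst x, snd x), (fst y, snd x)) \<in> linked L ({i..j} - {n})"
      by (rule linked_lift) (use x in auto)
    moreover have "snd y = snd x" using linked_project[OF down x] j by simp
    ultimately have "(x, y) \<in> linked L ({i..j} - {n})" by (metis prod.collapse)
    then show ?thesis by (rule linked_mono) blast
  qed
qed

section \<open>The facets of \<open>P|k\<close>\<close>

definition layer :: "nat \<Rightarrow> ('a \<times> nat) cgraph" where
  "layer l = induced (delete_color (int n) L) (flags P \<times> {l})"

text \<open>Paths without color \<open>n\<close> cannot leave a layer, and connectedness of
  \<open>P\<close>, lifted, joins all flags of the layer.\<close>

lemma face_of_L:
  assumes x: "x \<in> flags L"
  shows "face_of (int n) L x = layer (snd x)"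
proof -
  have "linked L {c. int c \<noteq> int n} `` {x} = flags P \<times> {snd x}" (is "?A = _")
  proof
    show "?A \<subseteq> flags P \<times> {snd x}"
    proof
      fix y assume y: "y \<in> ?A"
      then have "y \<in> flags L" using linked_flags[OF pre_L _ x] by blast
      then show "y \<in> flags P \<times> {snd x}" using linked_project[OF _ x] y by (cases y) fastforce
    qed
    show "flags P \<times> {snd x} \<subseteq> ?A"
    proof
      fix z assume "z \<in> flags P \<times> {snd x}"
      then obtain y where y: "y \<in> flags P" "z = (y, snd x)" by auto
      then have "((fst x, snd x), (y, snd x)) \<in> linked L (UNIV - {n})"
        using linked_lift[OF linked_P, of "fst x"] x by auto
      moreover have "UNIV - {n} = {c. int c \<noteq> int n}" by auto
      ultimately show "z \<in> ?A" using y(2) by simp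
    qed
  qed
  then show ?thesis unfolding face_of_def layer_def by simp
qed

lemma faces_L: "faces (int n) L = layer ` {1..k}"
proof -
  have "faces (int n) L = (\<lambda>x. layer (snd x)) ` flags L"
    unfolding faces_eq by (rule image_cong[OF refl face_of_L])
  then show ?thesis using flags_P_nonempty by (force simp: image_iff)
qed

lemma card_faces_L: "card (faces (int n) L) = k"
proof -
  have "inj_on layer {1..k}"
  proof (rule inj_onI)
    fix l m assume "layer l = layer m"
    then have "flags (layer l) = flags (layer m)" by simp
    then show "l = m" using flags_P_nonempty unfolding layer_def by auto
  qed
  then show ?thesis unfolding faces_L by (simp add: card_image)
qed

text \<open>Within one layer the index is constant, so \<open>fst\<close> is injective there; with
  color \<open>n\<close> deleted, the edges are exactly the copies of those of
  \<open>P\<close>.\<close>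

lemma layer_iso:
  assumes l: "l \<in> {1..k}"
  shows "cgraph_iso (layer l) P"
  unfolding cgraph_iso_def
proof (intro exI[of _ fst] conjI allI ballI)
  show "bij_betw fst (flags (layer l)) (flags P)"
    unfolding layer_def by (auto simp: bij_betw_def inj_on_def image_iff)
  fix c x y assume "x \<in> flags (layer l)" "y \<in> flags (layer l)"
  then have xy: "fst x \<in> flags P" "fst y \<in> flags P" "snd x = l" "snd y = l"
    unfolding layer_def by auto
  then have "{x, y} \<in> edges (layer l) c \<longleftrightarrow> c \<noteq> n \<and> {x, y} \<in> edges L c"
    unfolding layer_def induced_def delete_color_def by (auto simp: mem_Times_iff)
  also have "\<dots> \<longleftrightarrow> c < n \<and> fst y = nbr P c (fst x)"
    using edge_L_iff[of x y c] xy l by (auto simp: layer_nbr_def mem_Times_iff prod_eq_iff)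
  also have "\<dots> \<longleftrightarrow> {fst x, fst y} \<in> edges P c"
    using nbr_eq_iff[OF pre _ xy(1)] edge_color_less[OF pre] by metis
  finally show "{x, y} \<in> edges (layer l) c \<longleftrightarrow> {fst x, fst y} \<in> edges P c" .
qed

text \<open>The path that reaches a prescribed layer uses only colors \<open>n - 1\<close> and
  \<open>n\<close>, so it never leaves its \<open>(n - 2)\<close>-face.\<close>

lemma flat_L: "flat (int n - 2) (int n) L"
  unfolding flat_def
proof (intro ballI)
  fix F H assume F: "F \<in> faces (int n - 2) L" and H: "H \<in> faces (int n) L"
  obtain x where x: "x \<in> flags L" "F = face_of (int n - 2) L x"
    using F unfolding faces_eq by blast
  obtain m where m: "m \<in> {1..k}" "H = layer m" using H unfolding faces_L by blast
  obtain y where y: "y \<in> flags P" "((fst x, snd x), (y, m)) \<in> linked L {n - 1, n}"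
    using linked_every_layer[of "fst x" "snd x" m] x m by auto
  \<comment> \<open>For \<open>n = 1\<close> the deleted index is the integer -1, which no color
    equals, so the same inclusion of color sets holds.\<close>
  have "(x, (y, m)) \<in> linked L {c. int c \<noteq> int n - 2}"
    using linked_mono[OF y(2)] n by simp
  then show "incident F H"
    unfolding incident_def x(2) m(2) flags_face_of layer_def using y(1) by auto
qed

end

theorem theorem3p4:
  fixes n k :: nat and P :: "'a cgraph" and f :: "'a cgraph \<Rightarrow> hue"
  assumes "n \<ge> 1"
    and "polytope n P"
    and "facet_bipartite n P"
    and "even k" and "k > 0"
    and "proper_2_coloring (facet_graph n P) f"
  shows "polytope (n + 1) (layered n P f k) \<and>
    flat (int n - 2) (int n) (layered n P f k) \<and>
    card (facets (n + 1) (layered n P f k)) = k \<and>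
    (\<forall>F\<in>facets (n + 1) (layered n P f k). cgraph_iso F P)"
proof -
  interpret layering n k P f
    using assms by unfold_locales
  have "facets (n + 1) L = faces (int n) L" unfolding facets_def by simp
  then show ?thesis
    unfolding polytope_def
    using maniplex_L path_intersection_L flat_L card_faces_L faces_L layer_iso by auto
qed

end
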